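(* Let $m\ge 1$ be an integer. Let $\mathrm{Q}$ be the invariant measure of the Markov transition operator $\mathbf{M}$ and, for $x\in\mathcal X$, define \[ \mathfrak{R}_x = \mu(x)^{1/2}\,\frac{\mathrm{d}\mathbf{M}^m_x}{\mathrm{d}\mathrm{Q}} \in L^2_{\mathrm{Q}} . \] Then for all $x,y\in\mathcal X$, \[ K_m(x,y) = \Bigl\langle \frac{\mathfrak{R}_x }{\lVert \mathfrak{R}_x \rVert_{L^2_{\mathrm{Q}}}},\ \frac{\mathfrak{R}_y }{\lVert \mathfrak{R}_y \rVert_{L^2_{\mathrm{Q}}}} \Bigr\rangle_{L^2_{\mathrm{Q}}}. \]
   Context: Setting: $\mathcal X$ is a compact subset of a separable Hilbert space, $\mathrm P$ is a Borel probability measure on $\mathcal X$ whose support is a union of several compact connected components, $\beta>0$, and $K(x,y)=\exp(-\beta\|x-y\|^2)$ for $x,y\in\mathcal X$. Put \[ \mu(x)=\int K(x,z)\,\mathrm d\mathrm P(z),\qquad \overline K(x,y)=\mu(x)^{-1/2}K(x,y)\mu(y)^{-1/2}. \] For an integer $m\ge 1$ the iterated kernel is \[ \overline K_m(x,y)=\int \overline K(y,z_1)\overline K(z_1,z_2)\cdots\overline K(z_{m-1},x)\,\mathrm d\mathrm P^{\otimes(m-1)}(z_1,\dots,z_{m-1}), \] with $\overline K_1=\overline K$, and the normalized kernel is \[ K_m(x,y)=\overline K_{2m}(x,x)^{-1/2}\,\overline K_{2m}(x,y)\,\overline K_{2m}(y,y)^{-1/2}. \] The Markov transition operator $\mathbf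 M$ is $\mathbf M(f)(x)=\int M(x,z)f(z)\,\mathrm d\mathrm P(z)$ with $M(x,y)=\mu(x)^{-1}K(x,y)$. For $x\in\mathcal X$, $\mathbf M^m_x$ denotes the measure on $\mathcal X$ given by $f\mapsto \mathbf M^m(f)(x)$, where $\mathbf M^m$ is the $m$-th power of $\mathbf M$. An invariant measure of $\mathbf M$ is a nonzero finite Borel measure $\mathrm Q$ on $\mathcal X$ with $\int \mathbf M(f)\,\mathrm d\mathrm Q=\int f\,\mathrm d\mathrm Q$ for all bounded measurable $f$; it is determined up to a positive multiplicative constant (it is not required to be normalized to a probability). $\frac{\mathrm d\mathbf M^m_x}{\mathrm d\mathrm Q}$ is the Radon–Nikodym derivative. *)

theory Defs
  imports "HOL-Probability.Probability"
begin

text \<open>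
  A Borel measure on a subset \<open>X\<close> of the ambient space is a measure \<open>P\<close> with
  \<open>sets P = sets (restrict_space borel X)\<close>; in particular \<open>space P = X\<close>.
\<close>

definition measure_support :: "'a::topological_space measure \<Rightarrow> 'a set" where
  "measure_support P = {x \<in> space P. \<forall>U. open U \<and> x \<in> U \<longrightarrow> emeasure P (U \<inter> space P) > 0}"

definition gauss_kernel :: "real \<Rightarrow> 'a::real_normed_vector \<Rightarrow> 'a \<Rightarrow> real" where
  "gauss_kernel \<beta> x y = exp (- \<beta> * (norm (x - y))\<^sup>2)"

definition mu :: "real \<Rightarrow> 'a::real_normed_vector measure \<Rightarrow> 'a \<Rightarrow> real" where
  "mu \<beta> P x = (LINT z|P. gauss_kernel \<beta> x z)"

definition Kbar :: "real \<Rightarrow> 'a::real_normed_vector measure \<Rightarrow> 'a \<Rightarrow> 'a \<Rightarrow> real" where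
  "Kbar \<beta> P x y = mu \<beta> P x powr (-1/2) * gauss_kernel \<beta> x y * mu \<beta> P y powr (-1/2)"

text \<open>
  The integration variables are \<open>z 1, \<dots>, z (m - 1)\<close>; the update sets the endpoints
  \<open>z 0 = y\<close> and \<open>z m = x\<close> of the path. For \<open>m = 1\<close> the product measure is the
  point mass on the empty index set (see \<open>Kbar_iter_1\<close>). Only \<open>m \<ge> 1\<close> is meaningful.
\<close>

definition Kbar_iter :: "real \<Rightarrow> 'a::real_normed_vector measure \<Rightarrow> nat \<Rightarrow> 'a \<Rightarrow> 'a \<Rightarrow> real" where
  "Kbar_iter \<beta> P m x y =
     (LINT z|Pi\<^sub>M {1..<m} (\<lambda>_. P).
        (\<Prod>i<m. Kbar \<beta> P ((z(0 := y, m := x)) i) ((z(0 := y, m := x)) (Suc i))))"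

lemma Kbar_iter_1: "Kbar_iter \<beta> P 1 x y = Kbar \<beta> P x y"
  by (simp add: Kbar_iter_def Kbar_def PiM_empty lebesgue_integral_count_space_finite
      gauss_kernel_def norm_minus_commute mult_ac)

definition K_norm :: "real \<Rightarrow> 'a::real_normed_vector measure \<Rightarrow> nat \<Rightarrow> 'a \<Rightarrow> 'a \<Rightarrow> real" where
  "K_norm \<beta> P m x y =
     Kbar_iter \<beta> P (2 * m) x x powr (-1/2) * Kbar_iter \<beta> P (2 * m) x y
       * Kbar_iter \<beta> P (2 * m) y y powr (-1/2)"

definition markov_kernel :: "real \<Rightarrow> 'a::real_normed_vector measure \<Rightarrow> 'a \<Rightarrow> 'a \<Rightarrow> real" where
  "markov_kernel \<beta> P x y = inverse (mu \<beta> P x) * gauss_kernel \<beta> x y"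

definition markov_op ::
  "real \<Rightarrow> 'a::real_normed_vector measure \<Rightarrow> ('a \<Rightarrow> real) \<Rightarrow> 'a \<Rightarrow> real" where
  "markov_op \<beta> P f x = (LINT z|P. markov_kernel \<beta> P x z * f z)"

text \<open>
  The measure representing \<open>f \<mapsto> (markov_op \<beta> P ^^ m) f x\<close>, given by the values of this
  functional on indicator functions.
\<close>

definition markov_measure ::
  "real \<Rightarrow> 'a::real_normed_vector measure \<Rightarrow> nat \<Rightarrow> 'a \<Rightarrow> 'a measure" where
  "markov_measure \<beta> P m x =
     measure_of (space P) (sets P) (\<lambda>A. ennreal ((markov_op \<beta> P ^^ m) (indicator A) x))"

definition invariant_measure ::
  "real \<Rightarrow> 'a::real_normed_vector measure \<Rightarrow> 'a measure \<Rightarrow> bool" where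
  "invariant_measure \<beta> P Q \<longleftrightarrow>
     sets Q = sets P \<and> finite_measure Q \<and> emeasure Q (space Q) \<noteq> 0 \<and>
     (\<forall>f \<in> borel_measurable P. bounded (f ` space P) \<longrightarrow>
        (LINT x|Q. markov_op \<beta> P f x) = (LINT x|Q. f x))"

text \<open>Elements of \<open>L\<^sup>2\<close> are represented by functions rather than by their a.e.\ classes.\<close>

definition in_L2 :: "'a measure \<Rightarrow> ('a \<Rightarrow> real) \<Rightarrow> bool" where
  "in_L2 Q f \<longleftrightarrow> f \<in> borel_measurable Q \<and> integrable Q (\<lambda>z. (f z)\<^sup>2)"

definition L2_inner :: "'a measure \<Rightarrow> ('a \<Rightarrow> real) \<Rightarrow> ('a \<Rightarrow> real) \<Rightarrow> real" where
  "L2_inner Q f g = (LINT z|Q. f z * g z)"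

definition L2_norm :: "'a measure \<Rightarrow> ('a \<Rightarrow> real) \<Rightarrow> real" where
  "L2_norm Q f = sqrt (L2_inner Q f f)"

definition rep ::
  "real \<Rightarrow> 'a::real_normed_vector measure \<Rightarrow> 'a measure \<Rightarrow> nat \<Rightarrow> 'a \<Rightarrow> 'a \<Rightarrow> real" where
  "rep \<beta> P Q m x z =
     mu \<beta> P x powr (1/2) * enn2real (RN_deriv Q (markov_measure \<beta> P m x) z)"

end

theory Submission
  imports Defs
begin

text \<open>
  An invariant measure has the form \<open>Q = a \<mu> P\<close>: it is absolutely continuous with respect to
  \<open>P\<close>, and because \<open>\<mu> P\<close> is reversible for the Markov kernel, the density of \<open>Q\<close> with respect to
  \<open>\<mu> P\<close> is harmonic, hence constant as the Gaussian kernel is bounded below on a compact set.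
  The \<open>m\<close>-th power of the Markov operator has the kernel
  \<open>\<mu>(x)\<^sup>-\<^sup>1\<^sup>/\<^sup>2 Kbar\<^sub>m(x, z) \<mu>(z)\<^sup>1\<^sup>/\<^sup>2\<close> with respect to \<open>P\<close>, so the representation of \<open>x\<close> is
  \<open>Kbar\<^sub>m(x, z) / (a \<mu>(z)\<^sup>1\<^sup>/\<^sup>2)\<close>. By the semigroup property the inner product in \<open>L\<^sup>2(Q)\<close> of the
  representations of \<open>x\<close> and \<open>y\<close> is \<open>Kbar\<^sub>2\<^sub>m(x, y) / a\<close>, and \<open>a\<close> cancels on normalization.
\<close>

section \<open>Bounded integrands and exchange of integrals\<close>

lemma (in finite_measure) integrable_bounded:
  fixes f :: "'a \<Rightarrow> real"
  assumes "f \<in> borel_measurable M" "\<And>x. x \<in> space M \<Longrightarrow> \<bar>f x\<bar> \<le> B"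
  shows "integrable M f"
  using assms by (intro integrable_const_bound[of _ B]) auto

lemma (in prob_space) abs_integral_le_bound:
  fixes f :: "'a \<Rightarrow> real"
  assumes f: "f \<in> borel_measurable M" and B: "\<And>x. x \<in> space M \<Longrightarrow> \<bar>f x\<bar> \<le> B"
  shows "\<bar>\<integral>x. f x \<partial>M\<bar> \<le> B"
proof -
  have "\<bar>\<integral>x. f x \<partial>M\<bar> \<le> (\<integral>x. \<bar>f x\<bar> \<partial>M)" by (rule integral_abs_bound)
  also have "\<dots> \<le> B"
    using integrable_bounded[OF f B] B by (intro integral_le_const) auto
  finally show ?thesis .
qed

text \<open>A bounded measurable function is integrable on the product of two finite measures. Every
  exchange of integrals below thus reduces to joint measurability and a uniform bound.\<close>

lemma Fubini_bounded:
  fixes f :: "'a \<Rightarrow> 'b \<Rightarrow> real"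
  assumes "finite_measure M" "finite_measure N"
    and meas: "(\<lambda>(x, y). f x y) \<in> borel_measurable (M \<Otimes>\<^sub>M N)"
    and bound: "\<And>x y. x \<in> space M \<Longrightarrow> y \<in> space N \<Longrightarrow> \<bar>f x y\<bar> \<le> B"
  shows "(\<integral>x. (\<integral>y. f x y \<partial>N) \<partial>M) = (\<integral>y. (\<integral>x. f x y \<partial>M) \<partial>N)"
proof -
  interpret M: finite_measure M by fact
  interpret N: finite_measure N by fact
  interpret pair_sigma_finite M N ..
  interpret MN: finite_measure "M \<Otimes>\<^sub>M N"
    by (rule finite_measure_pair_measure) fact+
  have "integrable (M \<Otimes>\<^sub>M N) (\<lambda>(x, y). f x y)"
    using meas bound by (intro MN.integrable_bounded[of _ B]) (auto simp: space_pair_measure)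
  then show ?thesis by (rule Fubini_integral[symmetric])
qed

text \<open>The value \<open>a = 0\<close> is included: both sides are then 0 by the conventions for
  \<open>powr\<close> and division. The normalization of the iterated kernel can therefore rely on
  nonnegativity alone.\<close>

lemma powr_minus_half_eq:
  fixes a :: real
  assumes "a \<ge> 0"
  shows "a powr (-1/2) = 1 / sqrt a"
  using assms powr_minus_divide[of a "1/2"] by (simp add: powr_half_sqrt)

section \<open>The Gaussian kernel and its mean on a compact set\<close>

locale gauss_diffusion = prob_space P
  for P :: "'a::{real_normed_vector, second_countable_topology} measure" +
  fixes X :: "'a set" and \<beta> :: real
  assumes compact_X: "compact X"
    and sets_P: "sets P = sets (restrict_space borel X)"
    and \<beta>_pos: "\<beta> > 0"
begin

abbreviation "K \<equiv> gauss_kernel \<beta> :: 'a \<Rightarrow> 'a \<Rightarrow> real"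
abbreviation "\<mu> \<equiv> mu \<beta> P"
abbreviation "k \<equiv> Kbar_iter \<beta> P"

lemma space_eq_X: "space P = X"
  using sets_eq_imp_space_eq[OF sets_P] by (simp add: space_restrict_space)

lemma measurable_ident_P [measurable]: "(\<lambda>x. x) \<in> borel_measurable P"
proof -
  have "(\<lambda>x. x) \<in> borel_measurable (restrict_space borel X)"
    by (rule measurable_restrict_space1) simp
  then show ?thesis using measurable_cong_sets[OF sets_P refl] by blast
qed

text \<open>Second countability makes the difference of two Borel maps measurable, and the kernel is
  a continuous function of the norm of that difference.\<close>

lemma measurable_K [measurable]: "(\<lambda>(x, y). K x y) \<in> borel_measurable (P \<Otimes>\<^sub>M P)"
proof -
  have [measurable]: "(\<lambda>z. fst z - snd z) \<in> borel_measurable (P \<Otimes>\<^sub>M P)"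
    using measurable_compose[OF measurable_fst measurable_ident_P]
      measurable_compose[OF measurable_snd measurable_ident_P]
    by (intro borel_measurable_diff) auto
  show ?thesis
    unfolding gauss_kernel_def case_prod_unfold by measurable
qed

lemma K_commute: "K x y = K y x"
  by (simp add: gauss_kernel_def norm_minus_commute)

lemma K_le_1: "K x y \<le> 1"
  using \<beta>_pos by (simp add: gauss_kernel_def)

lemma K_pos: "K x y > 0"
  by (simp add: gauss_kernel_def)

text \<open>A compact set has finite diameter, so the value of the Gaussian at distance
  \<open>diameter X\<close> serves as the constant.\<close>

lemma K_lower_bound:
  obtains c where "c > 0" "\<And>x y. x \<in> X \<Longrightarrow> y \<in> X \<Longrightarrow> c \<le> K x y"
proof
  show "exp (- \<beta> * (diameter X)\<^sup>2) > 0" by simp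
  fix x y assume "x \<in> X" "y \<in> X"
  then have "norm (x - y) \<le> diameter X"
    using diameter_bounded_bound[OF compact_imp_bounded[OF compact_X]]
    by (simp add: dist_norm)
  then show "exp (- \<beta> * (diameter X)\<^sup>2) \<le> K x y"
    using \<beta>_pos by (simp add: gauss_kernel_def power_mono)
qed

lemma measurable_K_section [measurable]: "x \<in> X \<Longrightarrow> K x \<in> borel_measurable P"
  using measurable_compose[OF measurable_Pair1'[of x P P] measurable_K] space_eq_X by simp

lemma integrable_K: "x \<in> X \<Longrightarrow> integrable P (K x)"
  using K_le_1 K_pos by (intro integrable_bounded[of _ 1]) (auto simp: abs_of_pos)

lemma measurable_\<mu> [measurable]: "\<mu> \<in> borel_measurable P"
proof -
  have "(\<lambda>x. \<mu> x) \<in> borel_measurable P" unfolding mu_def by measurable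
  then show ?thesis by simp
qed

lemma \<mu>_le_1: "x \<in> X \<Longrightarrow> \<mu> x \<le> 1"
  unfolding mu_def using integrable_K K_le_1 by (intro integral_le_const) auto

text \<open>Averaging against a probability measure preserves the lower bound on \<open>K\<close>.
  Uniformity in \<open>x\<close> is what later bounds every quotient by \<mu>.\<close>

lemma \<mu>_lower_bound:
  obtains c where "c > 0" "\<And>x. x \<in> X \<Longrightarrow> c \<le> \<mu> x"
proof -
  obtain c where c: "c > 0" "\<And>x y. x \<in> X \<Longrightarrow> y \<in> X \<Longrightarrow> c \<le> K x y"
    by (rule K_lower_bound) blast
  have "c \<le> \<mu> x" if "x \<in> X" for x
    unfolding mu_def using integrable_K[OF that] c(2)[OF that] space_eq_X
    by (intro integral_ge_const) auto
  with c(1) show ?thesis using that by blast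
qed

lemma \<mu>_pos: "x \<in> X \<Longrightarrow> \<mu> x > 0"
  by (rule \<mu>_lower_bound) force

section \<open>The symmetrized kernel\<close>

lemma Kbar_eq: "x \<in> X \<Longrightarrow> y \<in> X \<Longrightarrow> Kbar \<beta> P x y = K x y / (sqrt (\<mu> x) * sqrt (\<mu> y))"
  using \<mu>_pos[of x] \<mu>_pos[of y] by (simp add: Kbar_def powr_minus_half_eq[simplified])

lemma Kbar_commute: "Kbar \<beta> P x y = Kbar \<beta> P y x"
  by (simp add: Kbar_def K_commute[of x y])

lemma Kbar_nonneg: "Kbar \<beta> P x y \<ge> 0"
  using K_pos[of x y] by (simp add: Kbar_def)

lemma measurable_Kbar [measurable]: "(\<lambda>(x, y). Kbar \<beta> P x y) \<in> borel_measurable (P \<Otimes>\<^sub>M P)"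
  unfolding Kbar_def by measurable

lemma measurable_Kbar_section [measurable]: "x \<in> X \<Longrightarrow> Kbar \<beta> P x \<in> borel_measurable P"
  using measurable_compose[OF measurable_Pair1'[of x P P] measurable_Kbar] space_eq_X by simp

lemma Kbar_bounded:
  obtains B where "B > 0" "\<And>x y. x \<in> X \<Longrightarrow> y \<in> X \<Longrightarrow> \<bar>Kbar \<beta> P x y\<bar> \<le> B"
proof -
  obtain c where c: "c > 0" "\<And>x. x \<in> X \<Longrightarrow> c \<le> \<mu> x"
    by (rule \<mu>_lower_bound) blast
  have "\<bar>Kbar \<beta> P x y\<bar> \<le> 1 / c" if "x \<in> X" "y \<in> X" for x y
  proof -
    have "c = sqrt c * sqrt c" using c(1) by simp
    also have "\<dots> \<le> sqrt (\<mu> x) * sqrt (\<mu> y)"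
      using c that by (intro mult_mono) (auto intro: less_imp_le \<mu>_pos)
    finally have "K x y / (sqrt (\<mu> x) * sqrt (\<mu> y)) \<le> 1 / c"
      using K_le_1[of x y] c(1) by (intro frac_le) auto
    then show ?thesis using Kbar_nonneg[of x y] Kbar_eq[OF that] by simp
  qed
  with c(1) show ?thesis using that[of "1 / c"] by simp
qed

section \<open>Iterated kernels: recursion, semigroup property, symmetry\<close>

lemma Kbar_iter_nonneg: "k n x y \<ge> 0"
  unfolding Kbar_iter_def by (intro integral_nonneg_AE AE_I2 prod_nonneg) (simp add: Kbar_nonneg)

text \<open>A point of the path is either a fixed endpoint, hence a constant function of
  \<open>z\<close>, or a coordinate projection.\<close>

lemma path_measurable:
  fixes i n :: nat
  assumes "x \<in> X" "y \<in> X" "i \<le> n"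
  shows "(\<lambda>z. (z(0 := y, n := x)) i) \<in> measurable (Pi\<^sub>M {1..<n} (\<lambda>_. P)) P"
proof (cases "i = n \<or> i = 0")
  case False
  then have "i \<in> {1..<n}" using assms(3) by auto
  then show ?thesis using measurable_component_singleton[of i "{1..<n}" "\<lambda>_. P"] by simp
next
  case True
  \<comment> \<open>For \<open>n = 0\<close> both updates hit the same index and the outer one wins,
    so the test is on \<open>i = n\<close>.\<close>
  then have "(\<lambda>z. (z(0 := y, n := x)) i) = (\<lambda>_. if i = n then x else y)" by auto
  then show ?thesis using assms space_eq_X by (simp only: measurable_const split: if_split) simp
qed

lemma path_product_measurable:
  assumes "x \<in> X" "y \<in> X"
  shows "(\<lambda>z. \<Prod>i<n. Kbar \<beta> P ((z(0 := y, n := x)) i) ((z(0 := y, n := x)) (Suc i)))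
    \<in> borel_measurable (Pi\<^sub>M {1..<n} (\<lambda>_. P))"
proof (intro borel_measurable_prod)
  fix i assume "i \<in> {..<n}"
  then have "(\<lambda>z. ((z(0 := y, n := x)) i, (z(0 := y, n := x)) (Suc i)))
      \<in> measurable (Pi\<^sub>M {1..<n} (\<lambda>_. P)) (P \<Otimes>\<^sub>M P)"
    using assms by (intro measurable_Pair path_measurable) auto
  from measurable_compose[OF this measurable_Kbar]
  show "(\<lambda>z. Kbar \<beta> P ((z(0 := y, n := x)) i) ((z(0 := y, n := x)) (Suc i)))
      \<in> borel_measurable (Pi\<^sub>M {1..<n} (\<lambda>_. P))"
    by simp
qed

text \<open>The last integration variable \<open>z n\<close> is split off: once it is fixed to
  \<open>w\<close>, the remaining path runs from \<open>y\<close> to \<open>w\<close> in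
  \<open>n\<close> steps. The condition \<open>n \<ge> 1\<close> guarantees that \<open>z n\<close>
  is an integration variable and not the starting point.\<close>

lemma Kbar_iter_Suc:
  assumes n: "n \<ge> 1" and xy: "x \<in> X" "y \<in> X"
  shows "k (Suc n) x y = (\<integral>w. Kbar \<beta> P x w * k n w y \<partial>P)"
proof -
  let ?\<Pi> = "\<lambda>n. Pi\<^sub>M {1..<n} (\<lambda>_::nat. P)"
  \<comment> \<open>This is the path integrand with the start \<open>y\<close> fixed; the end
    \<open>x\<close> stays a parameter because the recursion replaces it by
    \<open>w\<close>.\<close>
  define F where "F n x z = (\<Prod>i<n. Kbar \<beta> P ((z(0 := y, n := x)) i) ((z(0 := y, n := x)) (Suc i)))"
    for n x z
  have prob_\<Pi>: "prob_space (?\<Pi> n)" for n by (intro prob_space_PiM) (rule prob_space_axioms)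
  have finite_P: "finite_measure P" by (rule finite_measure_axioms)
  interpret product_prob_space "\<lambda>_::nat. P" ..
  have F_meas: "F n x \<in> borel_measurable (?\<Pi> n)" if "x \<in> X" for n x
    using path_product_measurable[OF that xy(2), of n] by (simp add: F_def[abs_def])
  obtain B where B: "B > 0" "\<And>x y. x \<in> X \<Longrightarrow> y \<in> X \<Longrightarrow> \<bar>Kbar \<beta> P x y\<bar> \<le> B"
    by (rule Kbar_bounded) blast
  have F_bound: "\<bar>F n x z\<bar> \<le> B ^ n" if xz: "x \<in> X" "z \<in> space (?\<Pi> n)" for n x z
  proof -
    have "(z(0 := y, n := x)) i \<in> X" if i: "i \<le> n" for i
      using measurable_space[OF path_measurable[OF xz(1) xy(2) i] xz(2)]
      by (simp only: space_eq_X)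
    then have "\<bar>F n x z\<bar> \<le> (\<Prod>i<n. B)"
      unfolding F_def abs_prod by (intro prod_mono) (auto intro!: B(2) simp del: fun_upd_apply)
    then show ?thesis by simp
  qed
  \<comment> \<open>The first \<open>n\<close> factors see only indices up to \<open>n\<close>, and
    since \<open>n\<close> is not 0 the update at \<open>n\<close> leaves the start untouched. The
    remaining factor joins \<open>w\<close> to \<open>x\<close>.\<close>
  have split: "F (Suc n) x (z(n := w)) = F n w z * Kbar \<beta> P w x" for z w
  proof -
    have "((z(n := w))(0 := y, Suc n := x)) i = (z(0 := y, n := w)) i" if "i \<le> n" for i
      using that n by auto
    then show ?thesis using n by (simp add: F_def del: fun_upd_apply) simp
  qed
  \<comment> \<open>This form of the index set lets the product integral be written as an iterated
    one with \<open>z n\<close> innermost.\<close>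
  have ins: "{1..<Suc n} = insert n {1..<n}" using n by auto
  have upd: "(\<lambda>(z, w). z(n := w)) \<in> measurable (?\<Pi> n \<Otimes>\<^sub>M P) (?\<Pi> (Suc n))"
    using measurable_add_dim[of n "{1..<n}" "\<lambda>_. P"] by (simp only: ins)
  have k_eq: "k n x y = (\<integral>z. F n x z \<partial>?\<Pi> n)" for n x
    by (simp only: Kbar_iter_def F_def)
  have "k (Suc n) x y = (\<integral>z. F (Suc n) x z \<partial>?\<Pi> (Suc n))" by (rule k_eq)
  also have "\<dots> = (\<integral>z. (\<integral>w. F (Suc n) x (z(n := w)) \<partial>P) \<partial>?\<Pi> n)"
  proof -
    interpret S: prob_space "?\<Pi> (Suc n)" by (rule prob_\<Pi>)
    have "integrable (?\<Pi> (Suc n)) (F (Suc n) x)"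
      using F_meas[OF xy(1)] F_bound[OF xy(1)] by (rule S.integrable_bounded)
    then show ?thesis unfolding ins by (intro product_integral_insert) auto
  qed
  also have "\<dots> = (\<integral>w. (\<integral>z. F (Suc n) x (z(n := w)) \<partial>?\<Pi> n) \<partial>P)"
  proof (rule Fubini_bounded)
    show "finite_measure (?\<Pi> n)" using prob_\<Pi>[of n] by (rule prob_space.finite_measure)
    show "finite_measure P" by (rule finite_P)
    show "(\<lambda>(z, w). F (Suc n) x (z(n := w))) \<in> borel_measurable (?\<Pi> n \<Otimes>\<^sub>M P)"
      using measurable_compose[OF upd F_meas[OF xy(1)]] by (simp add: case_prod_unfold)
    fix z w assume "z \<in> space (?\<Pi> n)" "w \<in> space P"
    then have "z(n := w) \<in> space (?\<Pi> (Suc n))"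
      using measurable_space[OF upd, of "(z, w)"] by (simp add: space_pair_measure)
    then show "\<bar>F (Suc n) x (z(n := w))\<bar> \<le> B ^ Suc n" by (rule F_bound[OF xy(1)])
  qed
  also have "\<dots> = (\<integral>w. Kbar \<beta> P x w * k n w y \<partial>P)"
    unfolding split integral_mult_left_zero k_eq[symmetric]
    by (simp add: Kbar_commute[of x] mult.commute)
  finally show ?thesis .
qed

lemma Kbar_iter_measurable [measurable]:
  assumes "n \<ge> 1"
  shows "(\<lambda>(x, y). k n x y) \<in> borel_measurable (P \<Otimes>\<^sub>M P)"
  using assms
proof (induction n rule: dec_induct)
  case base
  show ?case by (simp only: Kbar_iter_1 measurable_Kbar)
next
  case (step n)
  note [measurable] = step.IH
  have "(\<lambda>z. \<integral>w. Kbar \<beta> P (fst z) w * k n w (snd z) \<partial>P) \<in> borel_measurable (P \<Otimes>\<^sub>M P)"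
    by measurable
  \<comment> \<open>The recursion holds only for endpoints in \<open>X\<close>, so measurability is
    transferred by equality on the space of the product measure.\<close>
  moreover have "k (Suc n) (fst z) (snd z) = (\<integral>w. Kbar \<beta> P (fst z) w * k n w (snd z) \<partial>P)"
    if "z \<in> space (P \<Otimes>\<^sub>M P)" for z
    using that step.hyps space_eq_X by (intro Kbar_iter_Suc) (auto simp: space_pair_measure)
  ultimately show ?case
    by (subst measurable_cong[where g = "\<lambda>z. \<integral>w. Kbar \<beta> P (fst z) w * k n w (snd z) \<partial>P"])
      (auto simp: case_prod_unfold)
qed

lemma Kbar_iter_measurable_left [measurable]:
  "n \<ge> 1 \<Longrightarrow> y \<in> X \<Longrightarrow> (\<lambda>x. k n x y) \<in> borel_measurable P"
  using measurable_compose[OF measurable_Pair2'[of y P P] Kbar_iter_measurable] space_eq_X by simp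

lemma Kbar_iter_measurable_right [measurable]:
  "n \<ge> 1 \<Longrightarrow> x \<in> X \<Longrightarrow> k n x \<in> borel_measurable P"
  using measurable_compose[OF measurable_Pair1'[of x P P] Kbar_iter_measurable] space_eq_X by simp

lemma Kbar_iter_bounded:
  assumes "n \<ge> 1"
  obtains B where "B > 0" "\<And>x y. x \<in> X \<Longrightarrow> y \<in> X \<Longrightarrow> \<bar>k n x y\<bar> \<le> B"
proof -
  have "\<exists>B>0. \<forall>x\<in>X. \<forall>y\<in>X. \<bar>k n x y\<bar> \<le> B"
    using assms
  proof (induction n rule: dec_induct)
    case base
    show ?case unfolding Kbar_iter_1 by (rule Kbar_bounded) blast
  next
    case (step n)
    obtain B where B: "B > 0" "\<And>x y. x \<in> X \<Longrightarrow> y \<in> X \<Longrightarrow> \<bar>k n x y\<bar> \<le> B"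
      using step.IH by blast
    obtain C where C: "C > 0" "\<And>x y. x \<in> X \<Longrightarrow> y \<in> X \<Longrightarrow> \<bar>Kbar \<beta> P x y\<bar> \<le> C"
      by (rule Kbar_bounded) blast
    have "\<bar>k (Suc n) x y\<bar> \<le> C * B" if xy: "x \<in> X" "y \<in> X" for x y
      unfolding Kbar_iter_Suc[OF step.hyps(1) xy]
    proof (rule abs_integral_le_bound)
      show "(\<lambda>w. Kbar \<beta> P x w * k n w y) \<in> borel_measurable P"
        using step.hyps xy by measurable
      show "\<bar>Kbar \<beta> P x w * k n w y\<bar> \<le> C * B" if "w \<in> space P" for w
        using that xy space_eq_X B C by (auto simp: abs_mult intro!: mult_mono)
    qed
    then show ?case using B(1) C(1) by (intro exI[of _ "C * B"]) auto
  qed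
  then show ?thesis using that by blast
qed

text \<open>This is the Chapman-Kolmogorov identity. The recursion is the case of one step on the
  left; the induction step unfolds one factor, applies the hypothesis inside the integral, exchanges
  the integrals and folds the factor back.\<close>

lemma Kbar_iter_add:
  assumes "n \<ge> 1" "l \<ge> 1" "x \<in> X" "y \<in> X"
  shows "k (n + l) x y = (\<integral>w. k n x w * k l w y \<partial>P)"
  using assms(1,3)
proof (induction n arbitrary: x rule: dec_induct)
  case base
  then show ?case
    unfolding Kbar_iter_1 using Kbar_iter_Suc[OF assms(2) base assms(4)] by simp
next
  case (step n)
  obtain B where B: "B > 0" "\<And>x y. x \<in> X \<Longrightarrow> y \<in> X \<Longrightarrow> \<bar>k n x y\<bar> \<le> B"
    by (rule Kbar_iter_bounded[OF step.hyps(1)]) blast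
  obtain C where C: "C > 0" "\<And>x y. x \<in> X \<Longrightarrow> y \<in> X \<Longrightarrow> \<bar>Kbar \<beta> P x y\<bar> \<le> C"
    by (rule Kbar_bounded) blast
  obtain D where D: "D > 0" "\<And>x y. x \<in> X \<Longrightarrow> y \<in> X \<Longrightarrow> \<bar>k l x y\<bar> \<le> D"
    by (rule Kbar_iter_bounded[OF assms(2)]) blast
  note [measurable] = measurable_Kbar_section[OF step.prems]
  have "k (Suc n + l) x y = (\<integral>w. Kbar \<beta> P x w * k (n + l) w y \<partial>P)"
    using Kbar_iter_Suc[of "n + l" x y] step assms by simp
  also have "\<dots> = (\<integral>w. (\<integral>v. Kbar \<beta> P x w * k n w v * k l v y \<partial>P) \<partial>P)"
    using step.IH space_eq_X by (intro Bochner_Integration.integral_cong) (auto simp: mult.assoc)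
  also have "\<dots> = (\<integral>v. (\<integral>w. Kbar \<beta> P x w * k n w v * k l v y \<partial>P) \<partial>P)"
  proof (rule Fubini_bounded)
    note [measurable] = Kbar_iter_measurable[OF step.hyps(1)]
      Kbar_iter_measurable_left[OF assms(2,4)]
    show "(\<lambda>(w, v). Kbar \<beta> P x w * k n w v * k l v y) \<in> borel_measurable (P \<Otimes>\<^sub>M P)"
      by measurable
    show "\<bar>Kbar \<beta> P x w * k n w v * k l v y\<bar> \<le> C * B * D"
      if "w \<in> space P" "v \<in> space P" for w v
      using that step.prems assms(4) space_eq_X B C D by (auto simp: abs_mult intro!: mult_mono)
  qed (rule finite_measure_axioms)+
  also have "\<dots> = (\<integral>v. k (Suc n) x v * k l v y \<partial>P)"
    using Kbar_iter_Suc[OF step.hyps(1) step.prems] space_eq_X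
    by (intro Bochner_Integration.integral_cong) auto
  finally show ?case .
qed

text \<open>A factor removed at one end by the recursion is reattached at the other end by the
  semigroup property, the symmetry of \<open>Kbar\<close> and the induction hypothesis reversing the
  rest of the path.\<close>

lemma Kbar_iter_commute:
  assumes "n \<ge> 1" "x \<in> X" "y \<in> X"
  shows "k n x y = k n y x"
  using assms
proof (induction n arbitrary: x y rule: dec_induct)
  case base
  show ?case unfolding Kbar_iter_1 by (rule Kbar_commute)
next
  case (step n)
  have "k (Suc n) x y = (\<integral>w. Kbar \<beta> P x w * k n w y \<partial>P)"
    using step by (intro Kbar_iter_Suc)
  also have "\<dots> = (\<integral>w. k n y w * k 1 w x \<partial>P)"
    unfolding Kbar_iter_1 using step space_eq_X
    by (intro Bochner_Integration.integral_cong) (auto simp: Kbar_commute[of x])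
  also have "\<dots> = k (n + 1) y x"
    using step by (intro Kbar_iter_add[symmetric]) auto
  finally show ?case by simp
qed

section \<open>Powers of the Markov operator\<close>

text \<open>The Markov kernel is conjugate to the symmetric kernel through multiplication by the
  square root of \<mu>, so its powers are governed by the iterates of \<open>Kbar\<close>.\<close>

lemma markov_kernel_eq:
  assumes "x \<in> X" "z \<in> X"
  shows "markov_kernel \<beta> P x z = sqrt (\<mu> z) / sqrt (\<mu> x) * Kbar \<beta> P x z"
proof -
  have "markov_kernel \<beta> P x z = K x z / (sqrt (\<mu> x) * sqrt (\<mu> x))"
    using \<mu>_pos[OF assms(1)] by (simp add: markov_kernel_def divide_inverse)
  also have "\<dots> = sqrt (\<mu> z) / sqrt (\<mu> x) * Kbar \<beta> P x z"
    using \<mu>_pos[OF assms(2)] by (simp add: Kbar_eq assms)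
  finally show ?thesis .
qed

lemma markov_op_power:
  assumes "n \<ge> 1" "x \<in> X"
    and f [measurable]: "f \<in> borel_measurable P" and f_le: "\<And>z. z \<in> X \<Longrightarrow> \<bar>f z\<bar> \<le> A"
  shows "(markov_op \<beta> P ^^ n) f x = (\<integral>z. sqrt (\<mu> z) / sqrt (\<mu> x) * k n x z * f z \<partial>P)"
  using assms(1,2)
proof (induction n arbitrary: x rule: dec_induct)
  case base
  then have "markov_op \<beta> P f x = (\<integral>z. sqrt (\<mu> z) / sqrt (\<mu> x) * Kbar \<beta> P x z * f z \<partial>P)"
    unfolding markov_op_def using space_eq_X
    by (intro Bochner_Integration.integral_cong) (auto simp: markov_kernel_eq)
  then show ?case by (simp only: Kbar_iter_1) simp
next
  case (step n)
  obtain B where B: "B > 0" "\<And>x y. x \<in> X \<Longrightarrow> y \<in> X \<Longrightarrow> \<bar>k n x y\<bar> \<le> B"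
    by (rule Kbar_iter_bounded[OF step.hyps(1)]) blast
  obtain C where C: "C > 0" "\<And>x y. x \<in> X \<Longrightarrow> y \<in> X \<Longrightarrow> \<bar>Kbar \<beta> P x y\<bar> \<le> C"
    by (rule Kbar_bounded) blast
  note [measurable] = measurable_Kbar_section[OF step.prems]
  have "(markov_op \<beta> P ^^ Suc n) f x = (\<integral>w. markov_kernel \<beta> P x w * (markov_op \<beta> P ^^ n) f w \<partial>P)"
    by (simp add: markov_op_def)
  also have "\<dots> = (\<integral>w. (\<integral>z. sqrt (\<mu> z) / sqrt (\<mu> x) * (Kbar \<beta> P x w * k n w z) * f z \<partial>P) \<partial>P)"
  proof (intro Bochner_Integration.integral_cong refl)
    fix w assume "w \<in> space P"
    then have w: "w \<in> X" by (simp add: space_eq_X)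
    have "markov_kernel \<beta> P x w * (markov_op \<beta> P ^^ n) f w
        = (\<integral>z. markov_kernel \<beta> P x w * (sqrt (\<mu> z) / sqrt (\<mu> w) * k n w z * f z) \<partial>P)"
      using step.IH[OF w] by simp
    \<comment> \<open>The conjugating factors \<open>sqrt (\<mu> w)\<close> at the intermediate
      point cancel.\<close>
    also have "\<dots> = (\<integral>z. sqrt (\<mu> z) / sqrt (\<mu> x) * (Kbar \<beta> P x w * k n w z) * f z \<partial>P)"
      using \<mu>_pos[OF w] by (simp add: markov_kernel_eq[OF step.prems w] mult_ac)
    finally show "markov_kernel \<beta> P x w * (markov_op \<beta> P ^^ n) f w
        = (\<integral>z. sqrt (\<mu> z) / sqrt (\<mu> x) * (Kbar \<beta> P x w * k n w z) * f z \<partial>P)" .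
  qed
  also have "\<dots> = (\<integral>z. (\<integral>w. sqrt (\<mu> z) / sqrt (\<mu> x) * (Kbar \<beta> P x w * k n w z) * f z \<partial>P) \<partial>P)"
  proof (rule Fubini_bounded)
    note [measurable] = Kbar_iter_measurable[OF step.hyps(1)]
    show "(\<lambda>(w, z). sqrt (\<mu> z) / sqrt (\<mu> x) * (Kbar \<beta> P x w * k n w z) * f z)
        \<in> borel_measurable (P \<Otimes>\<^sub>M P)"
      by measurable
    fix w z assume "w \<in> space P" "z \<in> space P"
    then have wz: "w \<in> X" "z \<in> X" by (simp_all add: space_eq_X)
    have "\<bar>sqrt (\<mu> z) / sqrt (\<mu> x)\<bar> \<le> 1 / sqrt (\<mu> x)"
      using \<mu>_le_1[OF wz(2)] \<mu>_pos[OF wz(2)] \<mu>_pos[OF step.prems]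
      by (simp add: divide_right_mono)
    moreover have "A \<ge> 0" using f_le[OF wz(1)] by linarith
    ultimately show "\<bar>sqrt (\<mu> z) / sqrt (\<mu> x) * (Kbar \<beta> P x w * k n w z) * f z\<bar>
        \<le> 1 / sqrt (\<mu> x) * (C * B) * A"
      unfolding abs_mult using wz step.prems B C f_le \<mu>_pos[OF step.prems]
      by (intro mult_mono) (auto intro!: mult_nonneg_nonneg less_imp_le[of 0])
  qed (rule finite_measure_axioms)+
  also have "\<dots> = (\<integral>z. sqrt (\<mu> z) / sqrt (\<mu> x) * k (Suc n) x z * f z \<partial>P)"
    using Kbar_iter_Suc[OF step.hyps(1) step.prems] space_eq_X
    by (intro Bochner_Integration.integral_cong) auto
  finally show ?case .
qed

text \<open>\<open>measure_of\<close> returns the prescribed values only if they form a measure on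
  the given sets. Here they coincide with those of a density, by the kernel formula for powers
  applied to indicators.\<close>

lemma markov_measure_eq_density:
  assumes "n \<ge> 1" and x: "x \<in> X"
  shows "markov_measure \<beta> P n x = density P (\<lambda>z. ennreal (sqrt (\<mu> z) / sqrt (\<mu> x) * k n x z))"
proof -
  let ?p = "\<lambda>z. sqrt (\<mu> z) / sqrt (\<mu> x) * k n x z"
  let ?D = "density P (\<lambda>z. ennreal (?p z))"
  note [measurable] = Kbar_iter_measurable_right[OF assms]
  obtain B where B: "B > 0" "\<And>x y. x \<in> X \<Longrightarrow> y \<in> X \<Longrightarrow> \<bar>k n x y\<bar> \<le> B"
    by (rule Kbar_iter_bounded[OF assms(1)]) blast
  have p_nonneg: "?p z \<ge> 0" if "z \<in> X" for z
    using \<mu>_pos[OF x] \<mu>_pos[OF that] Kbar_iter_nonneg[of n x z] by simp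
  have p_le: "?p z \<le> 1 / sqrt (\<mu> x) * B" if "z \<in> X" for z
    using \<mu>_pos[OF x] \<mu>_le_1[OF that] B(1) B(2)[OF x that] Kbar_iter_nonneg[of n x z]
    by (intro mult_mono divide_right_mono) auto
  have "ennreal ((markov_op \<beta> P ^^ n) (indicator S) x) = emeasure ?D S" if S: "S \<in> sets P" for S
  proof -
    have "(markov_op \<beta> P ^^ n) (indicator S) x = (\<integral>z. ?p z * indicator S z \<partial>P)"
      using S by (intro markov_op_power[OF assms, of _ 1]) (auto simp: indicator_def)
    moreover have "integrable P (\<lambda>z. ?p z * indicator S z)"
    proof (rule integrable_bounded)
      show "(\<lambda>z. ?p z * indicator S z) \<in> borel_measurable P" using S by measurable
      show "\<bar>?p z * indicator S z\<bar> \<le> 1 / sqrt (\<mu> x) * B" if "z \<in> space P" for z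
        using p_nonneg[of z] p_le[of z] that space_eq_X by (auto simp: indicator_def abs_of_nonneg)
    qed
    then have "(\<integral>\<^sup>+z. ennreal (?p z * indicator S z) \<partial>P) = ennreal (\<integral>z. ?p z * indicator S z \<partial>P)"
      using p_nonneg space_eq_X
      by (intro nn_integral_eq_integral AE_I2 mult_nonneg_nonneg[of "?p _"]) auto
    moreover have "emeasure ?D S = (\<integral>\<^sup>+z. ennreal (?p z * indicator S z) \<partial>P)"
      using S by (subst emeasure_density) (auto intro!: nn_integral_cong simp: indicator_def)
    ultimately show ?thesis by simp
  qed
  then have "markov_measure \<beta> P n x = measure_of (space P) (sets P) (emeasure ?D)"
    unfolding markov_measure_def
    by (intro measure_of_eq) (auto simp: sets.space_closed sets.sigma_sets_eq)
  also have "\<dots> = ?D" using measure_of_of_measure[of ?D] by simp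
  finally show ?thesis .
qed

section \<open>Invariant measures\<close>

text \<open>
  The minimum principle: the excess of \<open>h\<close> over its infimum is again harmonic, and a lower bound
  on the Markov kernel makes it at least a positive multiple of its own mean.
\<close>

lemma harmonic_imp_constant:
  assumes h [measurable]: "h \<in> borel_measurable P" and h_le: "\<And>z. z \<in> X \<Longrightarrow> \<bar>h z\<bar> \<le> B"
    and harm: "\<And>z. z \<in> X \<Longrightarrow> h z = markov_op \<beta> P h z"
  obtains a where "\<And>z. z \<in> X \<Longrightarrow> h z = a"
proof -
  define a where "a = Inf (h ` X)"
  define g where "g z = h z - a" for z
  have X_ne: "X \<noteq> {}" using not_empty space_eq_X by simp
  have bdd: "bdd_below (h ` X)"
    using h_le by (intro bdd_belowI[of _ "-B"]) (force simp: abs_le_iff)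
  have g_nonneg: "g z \<ge> 0" if "z \<in> X" for z
    using cInf_lower[OF imageI[OF that] bdd] by (simp add: g_def a_def)
  have g_meas [measurable]: "g \<in> borel_measurable P" unfolding g_def[abs_def] by measurable
  have g_le: "\<bar>g z\<bar> \<le> B + \<bar>a\<bar>" if "z \<in> X" for z
    using h_le[OF that] by (simp add: g_def)
  have int_g: "integrable P g"
    using g_le space_eq_X by (intro integrable_bounded) auto
  have int_K: "integrable P (\<lambda>x. K z x * f x)"
    if "z \<in> X" "f \<in> borel_measurable P" and f_le: "\<And>x. x \<in> X \<Longrightarrow> \<bar>f x\<bar> \<le> C" for z f C
  proof (rule integrable_bounded)
    show "(\<lambda>x. K z x * f x) \<in> borel_measurable P" using that by measurable
    show "\<bar>K z x * f x\<bar> \<le> 1 * C" if "x \<in> space P" for x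
      unfolding abs_mult using that K_pos[of z x] K_le_1[of z x] space_eq_X f_le
      by (intro mult_mono) auto
  qed
  \<comment> \<open>The operator fixes constants, since \<open>K z\<close> integrates to
    \<open>\<mu> z\<close>; subtracting \<open>a\<close> therefore preserves harmonicity.\<close>
  have g_harm: "g z = inverse (\<mu> z) * (\<integral>x. K z x * g x \<partial>P)" if z: "z \<in> X" for z
  proof -
    have "(\<integral>x. K z x * g x \<partial>P) = (\<integral>x. K z x * h x - a * K z x \<partial>P)"
      by (simp add: g_def algebra_simps)
    also have "\<dots> = (\<integral>x. K z x * h x \<partial>P) - a * \<mu> z"
      using int_K[OF z h h_le] integrable_K[OF z] by (simp add: mu_def)
    finally show ?thesis
      using harm[OF z] \<mu>_pos[OF z]
      by (simp add: markov_op_def markov_kernel_def g_def mult.assoc right_diff_distrib)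
  qed
  obtain c where c: "c > 0" "\<And>x y. x \<in> X \<Longrightarrow> y \<in> X \<Longrightarrow> c \<le> K x y"
    by (rule K_lower_bound) blast
  let ?G = "\<integral>x. g x \<partial>P"
  have G_nonneg: "?G \<ge> 0" using g_nonneg space_eq_X by (intro integral_nonneg_AE) auto
  \<comment> \<open>The kernel bound compares \<open>c * ?G\<close> with the integral of
    \<open>K z x * g x\<close>, and \<open>\<mu> z \<le> 1\<close> means that dividing this
    nonnegative integral by \<open>\<mu> z\<close> cannot decrease it.\<close>
  have "a + c * ?G \<le> h z" if z: "z \<in> X" for z
  proof -
    have "c * ?G = (\<integral>x. c * g x \<partial>P)" by simp
    also have "\<dots> \<le> (\<integral>x. K z x * g x \<partial>P)"
      using int_g int_K[OF z g_meas g_le] c(2)[OF z] g_nonneg space_eq_X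
      by (intro integral_mono) (auto intro!: mult_right_mono)
    also have "\<dots> = 1 * (\<integral>x. K z x * g x \<partial>P)" by simp
    also have "\<dots> \<le> inverse (\<mu> z) * (\<integral>x. K z x * g x \<partial>P)"
      using \<mu>_pos[OF z] \<mu>_le_1[OF z] g_nonneg space_eq_X K_pos
      by (intro mult_right_mono integral_nonneg_AE AE_I2 mult_nonneg_nonneg)
        (auto intro: less_imp_le simp: one_le_inverse)
    finally show ?thesis using g_harm[OF z] by (simp add: g_def)
  qed
  \<comment> \<open>The left side does not depend on \<open>z\<close>. Since the infimum is
    \<open>a\<close> itself, the mean of \<open>g\<close> must vanish.\<close>
  then have "a + c * ?G \<le> Inf (h ` X)" using X_ne by (intro cInf_greatest) auto
  then have "a + c * ?G \<le> a" by (simp only: a_def)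
  then have "?G = 0" using c(1) G_nonneg by (simp add: mult_le_0_iff)
  then have "AE x in P. g x = 0"
    using integral_nonneg_eq_0_iff_AE[OF int_g] g_nonneg space_eq_X by auto
  \<comment> \<open>Harmonicity expresses \<open>g z\<close> as an integral against
    \<open>P\<close>, which upgrades vanishing almost everywhere to vanishing at every point of
    \<open>X\<close>.\<close>
  then have "h z = a" if z: "z \<in> X" for z
  proof -
    have "(\<integral>x. K z x * g x \<partial>P) = (\<integral>x. 0 \<partial>P)"
      using z \<open>AE x in P. g x = 0\<close> by (intro integral_cong_AE) auto
    then show ?thesis using g_harm[OF z] by (simp add: g_def)
  qed
  then show ?thesis using that by blast
qed

text \<open>Invariance tested on indicators produces a density \<open>q\<close> with respect to
  \<open>P\<close>. Feeding this density back into its own formula shows that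
  \<open>q / \<mu>\<close> is harmonic, hence a constant \<open>a\<close>; it is positive because
  \<open>Q\<close> is nonzero.\<close>

lemma invariant_measure_density:
  assumes "invariant_measure \<beta> P Q"
  obtains a where "a > 0" "Q = density P (\<lambda>z. ennreal (a * \<mu> z))"
proof -
  have sets_Q [measurable_cong]: "sets Q = sets P" and fin: "finite_measure Q"
    and Q_ne: "emeasure Q (space Q) \<noteq> 0"
    and inv: "\<And>f. f \<in> borel_measurable P \<Longrightarrow> bounded (f ` space P) \<Longrightarrow>
      (\<integral>x. markov_op \<beta> P f x \<partial>Q) = (\<integral>x. f x \<partial>Q)"
    using assms by (auto simp: invariant_measure_def)
  interpret Q: finite_measure Q by fact
  have space_Q: "space Q = X" using sets_eq_imp_space_eq[OF sets_Q] space_eq_X by simp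
  obtain c where c: "c > 0" "\<And>x. x \<in> X \<Longrightarrow> c \<le> \<mu> x"
    by (rule \<mu>_lower_bound) blast
  have M_nonneg: "K x z / \<mu> x \<ge> 0" if "x \<in> X" for x z
    using K_pos[of x z] \<mu>_pos[OF that] by simp
  have M_le: "K x z / \<mu> x \<le> 1 / c" if "x \<in> X" for x z
    using K_le_1[of x z] c(1) c(2)[OF that] by (intro frac_le) auto
  have M_meas [measurable]: "(\<lambda>(x, z). K x z / \<mu> x) \<in> borel_measurable (Q \<Otimes>\<^sub>M P)"
    by measurable
  have M_meas' [measurable]: "(\<lambda>(z, x). K x z / \<mu> x) \<in> borel_measurable (P \<Otimes>\<^sub>M Q)"
    by measurable
  \<comment> \<open>The Markov kernel is integrated over its starting point against
    \<open>Q\<close>; this is the density of the image of \<open>Q\<close> after one step.\<close>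
  define q where "q z = (\<integral>x. K x z / \<mu> x \<partial>Q)" for z
  have q_meas [measurable]: "q \<in> borel_measurable P"
    unfolding q_def[abs_def] by measurable
  have q_nonneg: "q z \<ge> 0" for z
    unfolding q_def using M_nonneg space_Q by (intro integral_nonneg_AE) auto
  have int_M: "integrable Q (\<lambda>x. K x z / \<mu> x)" if "z \<in> X" for z
  proof (rule Q.integrable_bounded)
    show "(\<lambda>x. K x z / \<mu> x) \<in> borel_measurable Q"
      using measurable_compose[OF measurable_Pair1'[of z P Q] M_meas'] that space_eq_X by simp
    show "\<bar>K x z / \<mu> x\<bar> \<le> 1 / c" if "x \<in> space Q" for x
      using M_nonneg[of x z] M_le[of x z] that space_Q by simp
  qed
  have q_le: "q z \<le> measure Q X / c" if "z \<in> X" for z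
  proof -
    have "q z \<le> (\<integral>x. 1 / c \<partial>Q)"
      unfolding q_def using int_M[OF that] M_le space_Q by (intro integral_mono) auto
    then show ?thesis by (simp add: space_Q)
  qed
  have Q_eq: "Q = density P (\<lambda>z. ennreal (q z))"
  proof (rule measure_eqI)
    show "sets Q = sets (density P (\<lambda>z. ennreal (q z)))" using sets_Q by simp
    fix S assume "S \<in> sets Q"
    then have S [measurable]: "S \<in> sets P" using sets_Q by simp
    have "measure Q S = (\<integral>x. indicator S x \<partial>Q)"
      using S sets_Q by simp
    also have "\<dots> = (\<integral>x. markov_op \<beta> P (indicator S) x \<partial>Q)"
      using S by (intro inv[symmetric]) (auto intro!: boundedI[of _ 1] simp: indicator_def)
    also have "\<dots> = (\<integral>x. (\<integral>z. K x z / \<mu> x * indicator S z \<partial>P) \<partial>Q)"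
      by (simp add: markov_op_def markov_kernel_def divide_inverse mult_ac)
    also have "\<dots> = (\<integral>z. (\<integral>x. K x z / \<mu> x * indicator S z \<partial>Q) \<partial>P)"
    proof (rule Fubini_bounded[OF fin finite_measure_axioms])
      show "(\<lambda>(x, z). K x z / \<mu> x * indicator S z) \<in> borel_measurable (Q \<Otimes>\<^sub>M P)"
        by measurable
      show "\<bar>K x z / \<mu> x * indicator S z\<bar> \<le> 1 / c" if "x \<in> space Q" for x z
        using M_nonneg[of x z] M_le[of x z] that space_Q c(1) by (auto simp: indicator_def)
    qed
    also have "\<dots> = (\<integral>z. q z * indicator S z \<partial>P)" by (simp only: q_def integral_mult_left_zero)
    finally have "emeasure Q S = ennreal (\<integral>z. q z * indicator S z \<partial>P)"
      by (simp add: Q.emeasure_eq_measure)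
    also have "\<dots> = (\<integral>\<^sup>+z. ennreal (q z * indicator S z) \<partial>P)"
    proof (rule nn_integral_eq_integral[symmetric])
      show "integrable P (\<lambda>z. q z * indicator S z)"
        using q_nonneg q_le space_eq_X c(1)
        by (intro integrable_bounded[of _ "measure Q X / c"]) (auto simp: indicator_def)
    qed (use q_nonneg in auto)
    also have "\<dots> = emeasure (density P (\<lambda>z. ennreal (q z))) S"
      using S by (subst emeasure_density) (auto intro!: nn_integral_cong simp: indicator_def)
    finally show "emeasure Q S = emeasure (density P (\<lambda>z. ennreal (q z))) S" .
  qed
  define h where "h z = q z / \<mu> z" for z
  have "h z = markov_op \<beta> P h z" if z: "z \<in> X" for z
  proof -
    have [measurable]: "(\<lambda>x. K x z / \<mu> x) \<in> borel_measurable P"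
      using borel_measurable_integrable[OF int_M[OF z]] sets_Q
      by (simp add: measurable_cong_sets[OF sets_Q refl])
    \<comment> \<open>The integral against \<open>Q\<close> in the definition of \<open>q\<close> is
      rewritten with the density just found. Dividing by \<open>\<mu> z\<close> and using the
      symmetry of \<open>K\<close> then gives the Markov operator applied to
      \<open>h\<close>.\<close>
    have "q z = (\<integral>x. q x * (K x z / \<mu> x) \<partial>P)"
      using q_nonneg unfolding q_def[of z] Q_eq
      by (subst integral_density) auto
    then have "h z = (\<integral>x. q x * (K x z / \<mu> x) / \<mu> z \<partial>P)"
      by (simp only: h_def integral_divide_zero)
    also have "\<dots> = markov_op \<beta> P h z"
      unfolding markov_op_def
      by (intro Bochner_Integration.integral_cong)
        (simp_all add: h_def markov_kernel_def K_commute[of z] divide_inverse mult_ac)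
    finally show ?thesis .
  qed
  moreover have "\<bar>h z\<bar> \<le> measure Q X / c / c" if z: "z \<in> X" for z
  proof -
    have "q z / \<mu> z \<le> measure Q X / c / c"
      by (rule frac_le[OF order_trans[OF q_nonneg q_le[OF z]] q_le[OF z] c(1) c(2)[OF z]])
    then show ?thesis using q_nonneg[of z] \<mu>_pos[OF z] by (simp add: h_def)
  qed
  moreover have "h \<in> borel_measurable P" unfolding h_def[abs_def] by measurable
  ultimately obtain a where a: "\<And>z. z \<in> X \<Longrightarrow> h z = a"
    using harmonic_imp_constant by blast
  have "Q = density P (\<lambda>z. ennreal (a * \<mu> z))"
    unfolding Q_eq
  proof (intro density_cong AE_I2)
    fix z assume "z \<in> space P"
    then show "ennreal (q z) = ennreal (a * \<mu> z)"
      using a[of z] \<mu>_pos[of z] space_eq_X by (simp add: h_def field_simps)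
  qed auto
  moreover have "a > 0"
  proof -
    obtain z where z: "z \<in> X" using not_empty space_eq_X by blast
    have "h z \<ge> 0" using q_nonneg[of z] \<mu>_pos[OF z] by (simp add: h_def)
    then have "a \<ge> 0" by (simp only: a[OF z])
    moreover have "a \<noteq> 0"
    proof
      assume "a = 0"
      then have "emeasure Q (space Q) = 0"
        using \<open>Q = density P (\<lambda>z. ennreal (a * \<mu> z))\<close> by (simp add: emeasure_density)
      with Q_ne show False by simp
    qed
    ultimately show ?thesis by simp
  qed
  ultimately show ?thesis using that by blast
qed


section \<open>Representations and their inner products\<close>

text \<open>Dividing the density with respect to \<open>P\<close> by \<open>a * \<mu> z\<close>
  gives the one with respect to \<open>Q\<close>. The prefactor of \<open>rep\<close> then removes
  \<open>sqrt (\<mu> x)\<close>. The equality is only almost everywhere because a Radon-Nikodym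
  derivative is determined only up to null sets.\<close>

lemma rep_AE:
  assumes "a > 0" and Q: "Q = density P (\<lambda>z. ennreal (a * \<mu> z))" and "n \<ge> 1" "x \<in> X"
  shows "absolutely_continuous Q (markov_measure \<beta> P n x)"
    and "AE z in Q. rep \<beta> P Q n x z = k n x z / (a * sqrt (\<mu> z))"
proof -
  let ?r = "\<lambda>z. k n x z / (a * sqrt (\<mu> x) * sqrt (\<mu> z))"
  note [measurable] = Kbar_iter_measurable_right[OF assms(3,4)]
  have sets_Q [measurable_cong]: "sets Q = sets P" by (simp add: Q)
  have space_Q: "space Q = X" by (simp add: Q space_eq_X)
  interpret Q: sigma_finite_measure Q
    unfolding Q by (subst sigma_finite_iff_density_finite) auto
  have r_meas: "(\<lambda>z. ennreal (?r z)) \<in> borel_measurable Q" by measurable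
  have dens: "density Q (\<lambda>z. ennreal (?r z)) = markov_measure \<beta> P n x"
  proof -
    have "density Q (\<lambda>z. ennreal (?r z)) = density P (\<lambda>z. ennreal (a * \<mu> z) * ennreal (?r z))"
      unfolding Q by (rule density_density_eq) measurable
    also have "\<dots> = density P (\<lambda>z. ennreal (sqrt (\<mu> z) / sqrt (\<mu> x) * k n x z))"
    proof (intro density_cong AE_I2)
      fix z assume "z \<in> space P"
      then have z: "\<mu> z > 0" using \<mu>_pos space_eq_X by simp
      have "a * \<mu> z * ?r z = a * (sqrt (\<mu> z) * sqrt (\<mu> z)) * ?r z" using z by simp
      also have "\<dots> = sqrt (\<mu> z) / sqrt (\<mu> x) * k n x z"
        using z \<open>a > 0\<close> by (simp del: real_sqrt_mult_self)
      finally show "ennreal (a * \<mu> z) * ennreal (?r z)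
          = ennreal (sqrt (\<mu> z) / sqrt (\<mu> x) * k n x z)"
        using z \<open>a > 0\<close> by (subst ennreal_mult'[symmetric]) auto
    qed measurable
    finally show ?thesis by (simp add: markov_measure_eq_density[OF assms(3,4)])
  qed
  show "absolutely_continuous Q (markov_measure \<beta> P n x)"
    unfolding dens[symmetric] by (rule absolutely_continuousI_density[OF r_meas])
  have "AE z in Q. ennreal (?r z) = RN_deriv Q (markov_measure \<beta> P n x) z"
    by (rule Q.RN_deriv_unique[OF r_meas dens])
  then show "AE z in Q. rep \<beta> P Q n x z = k n x z / (a * sqrt (\<mu> z))"
    using AE_space
  proof eventually_elim
    case (elim z)
    then have "?r z \<ge> 0"
      using \<open>a > 0\<close> \<mu>_pos[of z] \<mu>_pos[OF assms(4)] Kbar_iter_nonneg[of n x z] space_Q by simp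
    then have "enn2real (RN_deriv Q (markov_measure \<beta> P n x) z) = ?r z"
      using elim(1) by (metis enn2real_ennreal)
    then show ?case
      using \<mu>_pos[OF assms(4)] by (simp add: rep_def powr_half_sqrt)
  qed
qed

text \<open>The density of \<open>Q\<close> cancels the two square roots in \<open>z\<close> and one
  factor \<open>a\<close>; symmetry and the semigroup property then join the two paths of length
  \<open>n\<close> at \<open>z\<close>. The case \<open>x = y\<close> gives square
  integrability.\<close>

lemma rep_inner:
  assumes "a > 0" and Q: "Q = density P (\<lambda>z. ennreal (a * \<mu> z))" and n: "n \<ge> 1"
    and xy: "x \<in> X" "y \<in> X"
  shows "integrable Q (\<lambda>z. rep \<beta> P Q n x z * rep \<beta> P Q n y z)"
    and "L2_inner Q (rep \<beta> P Q n x) (rep \<beta> P Q n y) = k (2 * n) x y / a"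
proof -
  let ?f = "\<lambda>x z. k n x z / (a * sqrt (\<mu> z))"
  note [measurable] = Kbar_iter_measurable_right[OF n xy(1)] Kbar_iter_measurable_right[OF n xy(2)]
  have sets_Q [measurable_cong]: "sets Q = sets P" by (simp add: Q)
  have rep_meas [measurable]: "rep \<beta> P Q n x \<in> borel_measurable Q" for x
    unfolding rep_def[abs_def] by measurable
  have eq: "AE z in Q. rep \<beta> P Q n x z * rep \<beta> P Q n y z = ?f x z * ?f y z"
    using rep_AE(2)[OF assms(1-4)] rep_AE(2)[OF assms(1-3,5)] by eventually_elim simp
  have weight: "a * \<mu> z * (?f x z * ?f y z) = k n x z * k n z y / a" if "z \<in> X" for z
  proof -
    have "a * \<mu> z * (?f x z * ?f y z) = a * (sqrt (\<mu> z) * sqrt (\<mu> z)) * (?f x z * ?f y z)"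
      using \<mu>_pos[OF that] by simp
    also have "\<dots> = k n x z * k n y z / a"
      using \<mu>_pos[OF that] \<open>a > 0\<close> by (simp del: real_sqrt_mult_self)
    finally show ?thesis by (simp add: Kbar_iter_commute[OF n xy(2) that])
  qed
  have nonneg: "AE z in P. 0 \<le> a * \<mu> z"
    using \<open>a > 0\<close> \<mu>_pos space_eq_X by (auto intro!: mult_nonneg_nonneg less_imp_le)
  obtain B where B: "B > 0" "\<And>x y. x \<in> X \<Longrightarrow> y \<in> X \<Longrightarrow> \<bar>k n x y\<bar> \<le> B"
    by (rule Kbar_iter_bounded[OF n]) blast
  have int: "integrable P (\<lambda>z. k n x z * k n z y / a)"
  proof (rule integrable_bounded)
    show "(\<lambda>z. k n x z * k n z y / a) \<in> borel_measurable P"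
      using Kbar_iter_measurable_left[OF n xy(2)] by measurable
    show "\<bar>k n x z * k n z y / a\<bar> \<le> B * B / a" if "z \<in> space P" for z
      using that B xy space_eq_X \<open>a > 0\<close>
      by (auto simp: abs_mult intro!: mult_mono divide_right_mono)
  qed
  have "integrable Q (\<lambda>z. ?f x z * ?f y z)"
    unfolding Q using nonneg int weight space_eq_X
    by (subst integrable_density)
      (auto intro: Bochner_Integration.integrable_cong[THEN iffD1, rotated -1])
  then show "integrable Q (\<lambda>z. rep \<beta> P Q n x z * rep \<beta> P Q n y z)"
    using eq by (subst integrable_cong_AE) auto
  have "L2_inner Q (rep \<beta> P Q n x) (rep \<beta> P Q n y) = (\<integral>z. ?f x z * ?f y z \<partial>Q)"
    unfolding L2_inner_def using eq by (intro integral_cong_AE) auto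
  also have "\<dots> = (\<integral>z. a * \<mu> z * (?f x z * ?f y z) \<partial>P)"
    unfolding Q using nonneg by (subst integral_density) auto
  also have "\<dots> = (\<integral>z. k n x z * k n z y / a \<partial>P)"
    using weight space_eq_X by (intro Bochner_Integration.integral_cong) auto
  also have "\<dots> = k (n + n) x y / a"
    by (simp add: Kbar_iter_add[OF n n xy])
  finally show "L2_inner Q (rep \<beta> P Q n x) (rep \<beta> P Q n y) = k (2 * n) x y / a"
    by (simp add: mult_2)
qed

end

section \<open>Normalization and cancellation of the scale of the invariant measure\<close>

theorem proposition1:
  fixes X :: "'a::{real_inner, banach, second_countable_topology} set"
    and P Q :: "'a measure"
    and \<beta> :: real
    and m :: nat
  assumes "compact X"
    and "sets P = sets (restrict_space borel X)"
    and "prob_space P"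
    and "finite (components (measure_support P))"
    and "\<forall>C \<in> components (measure_support P). compact C"
    and "\<beta> > 0"
    and "m \<ge> 1"
    and "invariant_measure \<beta> P Q"
  shows "(\<forall>x \<in> X. absolutely_continuous Q (markov_measure \<beta> P m x) \<and> in_L2 Q (rep \<beta> P Q m x)) \<and>
    (\<forall>x \<in> X. \<forall>y \<in> X.
       K_norm \<beta> P m x y =
         L2_inner Q (\<lambda>z. rep \<beta> P Q m x z / L2_norm Q (rep \<beta> P Q m x))
                    (\<lambda>z. rep \<beta> P Q m y z / L2_norm Q (rep \<beta> P Q m y)))"
proof -
  interpret prob_space P by fact
  interpret gauss_diffusion P X \<beta>
    using assms by unfold_locales auto
  obtain a where a: "a > 0" and Q: "Q = density P (\<lambda>z. ennreal (a * \<mu> z))"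
    using invariant_measure_density[OF assms(8)] by blast
  have "in_L2 Q (rep \<beta> P Q m x)" if "x \<in> X" for x
    using rep_inner(1)[OF a Q assms(7) that that]
    by (simp add: in_L2_def rep_def[abs_def] power2_eq_square Q)
  moreover have "K_norm \<beta> P m x y =
      L2_inner Q (\<lambda>z. rep \<beta> P Q m x z / L2_norm Q (rep \<beta> P Q m x))
        (\<lambda>z. rep \<beta> P Q m y z / L2_norm Q (rep \<beta> P Q m y))" if xy: "x \<in> X" "y \<in> X" for x y
  proof -
    let ?N = "\<lambda>x. L2_norm Q (rep \<beta> P Q m x)"
    have N: "?N x = sqrt (k (2 * m) x x) / sqrt a" if "x \<in> X" for x
      by (simp add: L2_norm_def rep_inner(2)[OF a Q assms(7) that that] real_sqrt_divide)
    have "L2_inner Q (\<lambda>z. rep \<beta> P Q m x z / ?N x) (\<lambda>z. rep \<beta> P Q m y z / ?N y)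
        = L2_inner Q (rep \<beta> P Q m x) (rep \<beta> P Q m y) / (?N x * ?N y)"
      by (simp add: L2_inner_def)
    also have "\<dots> = k (2 * m) x y / a / (?N x * ?N y)"
      by (simp only: rep_inner(2)[OF a Q assms(7) xy])
    \<comment> \<open>Each norm carries a factor \<open>1 / sqrt a\<close>, and their product
      cancels the \<open>1 / a\<close> of the inner product.\<close>
    also have "\<dots> = k (2 * m) x y / (sqrt (k (2 * m) x x) * sqrt (k (2 * m) y y))"
      using a by (simp add: N xy)
    also have "\<dots> = K_norm \<beta> P m x y"
      unfolding K_norm_def powr_minus_half_eq[OF Kbar_iter_nonneg] by simp
    finally show ?thesis by simp
  qed
  ultimately show ?thesis using rep_AE(1)[OF a Q assms(7)] by blast
qed

end
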